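(* Let $T$ be a tree of order $n\ge 2$ with vertex set $V$, and suppose there exists a $\gamma(T)$-set $D$ (a dominating set of $T$ of minimum cardinality) such that $V\setminus D$ is an independent set. Then $\gamma_{MR}(T)\le 3\gamma(T)-n$. This upper bound is sharp: it is attained by the path $P_5$ on $5$ vertices.
   Context: All graphs are finite and simple. For a vertex $v$ of $G=(V,E)$, $N[v]=\{v\}\cup\{u: uv\in E\}$ is the closed neighborhood, and for $f:V\to\mathbb{R}$ and $S\subseteq V$, $f(S)=\sum_{x\in S}f(x)$. A majority Roman dominating function (MRDF) on $G$ is a function $f:V\to\{-1,1,2\}$ such that (i) $f(N[v])\ge 1$ for at least half of the vertices $v\in V$, and (ii) every vertex $u$ with $f(u)=-1$ is adjacent to at least one vertex $w$ with $f(w)=2$. The weight of $f$ is $f(V)$, and the majority Roman domination number $\gamma_{MR}(G)$ is the minimum weight of an MRDF on $G$. A set $S\subseteq V$ is dominating if every vertex of $V\setminus S$ is adjacent to a vertex of $S$; the domination number $\gamma(G)$ is the minimum cardinality of a dominating set. *)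

theory Defs
  imports "Graph_Theory.Graph_Theory" "HOL-Library.FuncSet"
begin

text \<open>
  A finite simple graph is a \<^locale>\<open>pair_graph\<close>: a finite, loop-free digraph without parallel
  arcs whose arc relation is symmetric; the edge \<open>uv\<close> is the pair of arcs \<open>(u, v)\<close>, \<open>(v, u)\<close>.

  The library's \<^const>\<open>tree\<close> is unsuitable for such graphs, because every edge gives the directed
  cycle \<open>u, v, u\<close>. A cycle of the undirected graph is a directed cycle of length at least 3.
\<close>

definition undirected_tree :: "'a pair_pre_digraph \<Rightarrow> bool" where
  "undirected_tree G \<longleftrightarrow> pair_graph G \<and> connected (with_proj G) \<and>
     \<not> (\<exists>p. pre_digraph.cycle (with_proj G) p \<and> 3 \<le> length p)"

definition path_graph :: "nat \<Rightarrow> nat pair_pre_digraph" where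
  "path_graph n = \<lparr> pverts = {..<n},
     parcs = {(i, j). i < n \<and> j < n \<and> (j = Suc i \<or> i = Suc j)} \<rparr>"

definition closed_nbhd :: "'a pair_pre_digraph \<Rightarrow> 'a \<Rightarrow> 'a set" where
  "closed_nbhd G v = {v} \<union> {u. (u, v) \<in> parcs G}"

definition independent_set :: "'a pair_pre_digraph \<Rightarrow> 'a set \<Rightarrow> bool" where
  "independent_set G S \<longleftrightarrow> S \<subseteq> pverts G \<and> (\<forall>u\<in>S. \<forall>v\<in>S. (u, v) \<notin> parcs G)"

definition dominating_set :: "'a pair_pre_digraph \<Rightarrow> 'a set \<Rightarrow> bool" where
  "dominating_set G S \<longleftrightarrow> S \<subseteq> pverts G \<and> (\<forall>v\<in>pverts G - S. \<exists>u\<in>S. (v, u) \<in> parcs G)"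

definition domination_number :: "'a pair_pre_digraph \<Rightarrow> nat" where
  "domination_number G = Min (card ` {S. dominating_set G S})"

definition gamma_set :: "'a pair_pre_digraph \<Rightarrow> 'a set \<Rightarrow> bool" where
  "gamma_set G D \<longleftrightarrow> dominating_set G D \<and> card D = domination_number G"

text \<open>The extensional function space makes the set of all such functions finite.\<close>

definition mrdf :: "'a pair_pre_digraph \<Rightarrow> ('a \<Rightarrow> int) \<Rightarrow> bool" where
  "mrdf G f \<longleftrightarrow> f \<in> pverts G \<rightarrow>\<^sub>E {-1, 1, 2} \<and>
     card (pverts G) \<le> 2 * card {v \<in> pverts G. 1 \<le> sum f (closed_nbhd G v)} \<and>
     (\<forall>u\<in>pverts G. f u = -1 \<longrightarrow> (\<exists>w\<in>pverts G. (u, w) \<in> parcs G \<and> f w = 2))"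

definition majority_roman_number :: "'a pair_pre_digraph \<Rightarrow> int" where
  "majority_roman_number G = Min ((\<lambda>f. sum f (pverts G)) ` {f. mrdf G f})"

text \<open>On finite simple graphs both minima are taken over finite nonempty sets.\<close>

lemma dominating_sets_finite_nonempty:
  assumes "pair_graph G"
  shows "finite {S. dominating_set G S}" and "{S. dominating_set G S} \<noteq> {}"
proof -
  interpret pair_graph G by fact
  have "{S. dominating_set G S} \<subseteq> Pow (pverts G)"
    by (auto simp: dominating_set_def)
  then show "finite {S. dominating_set G S}"
    using pair_finite_verts by (meson finite_Pow_iff finite_subset)
  have "dominating_set G (pverts G)" by (simp add: dominating_set_def)
  then show "{S. dominating_set G S} \<noteq> {}" by blast
qed

lemma mrdfs_finite_nonempty:
  assumes "pair_graph G"
  shows "finite {f. mrdf G f}" and "{f. mrdf G f} \<noteq> {}"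
proof -
  interpret pair_graph G by fact
  have "{f. mrdf G f} \<subseteq> pverts G \<rightarrow>\<^sub>E {-1, 1, 2}"
    by (auto simp: mrdf_def)
  moreover have "finite (pverts G \<rightarrow>\<^sub>E {-1, 1, 2 :: int})"
    using pair_finite_verts by (intro finite_PiE) auto
  ultimately show "finite {f. mrdf G f}" by (rule finite_subset)
  let ?f = "\<lambda>v\<in>pverts G. 1 :: int"
  have "1 \<le> sum ?f (closed_nbhd G v)" if v: "v \<in> pverts G" for v
  proof -
    have sub: "closed_nbhd G v \<subseteq> pverts G"
      using v by (auto simp: closed_nbhd_def dest: in_arcsD1)
    then have "finite (closed_nbhd G v)"
      using pair_finite_verts by (rule finite_subset)
    moreover have "v \<in> closed_nbhd G v" by (simp add: closed_nbhd_def)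
    ultimately have "?f v \<le> sum ?f (closed_nbhd G v)"
      using sub by (intro member_le_sum) auto
    then show ?thesis using v by simp
  qed
  then have "{v \<in> pverts G. 1 \<le> sum ?f (closed_nbhd G v)} = pverts G" by blast
  then have "mrdf G ?f"
    unfolding mrdf_def by auto
  then show "{f. mrdf G f} \<noteq> {}" by blast
qed

end

theory Submission
  imports Defs
begin

text \<open>
  Assign 2 to the vertices of \<open>D\<close> and -1 to all others; the weight is \<open>3 \<gamma> - n\<close>. A vertex outside
  \<open>D\<close> has all its neighbours in \<open>D\<close>, and at least one of them, so its closed neighbourhood has
  positive weight. There are enough such vertices: by minimality of \<open>D\<close> and since there are no
  isolated vertices, the complement of \<open>D\<close> is dominating as well (Ore), hence has at least \<open>\<gamma>\<close>
  elements. On \<open>P\<^sub>5\<close> condition (ii) alone forces positive weight, because a vertex of value 2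
  serves at most two vertices of value -1.
\<close>

section \<open>Upper bound for connected graphs\<close>

lemma domination_number_le:
  assumes "pair_graph G" "dominating_set G S"
  shows "domination_number G \<le> card S"
  unfolding domination_number_def
  using assms dominating_sets_finite_nonempty(1) by (intro Min_le) auto

lemma majority_roman_number_le:
  assumes "pair_graph G" "mrdf G f"
  shows "majority_roman_number G \<le> sum f (pverts G)"
  unfolding majority_roman_number_def
  using assms mrdfs_finite_nonempty(1) by (intro Min_le) auto

text \<open>A walk from \<open>v\<close> to a second vertex begins with an arc at
  \<open>v\<close>.\<close>

lemma connected_imp_neighbour:
  assumes "pair_graph G" "connected (with_proj G)" "2 \<le> card (pverts G)" "v \<in> pverts G"
  obtains u where "(v, u) \<in> parcs G"
proof -
  interpret pair_graph G by fact
  have "\<not> pverts G \<subseteq> {v}"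
    using assms(3) card_mono[of "{v}" "pverts G"] by auto
  then obtain w where w: "w \<in> pverts G" "w \<noteq> v" by blast
  \<comment> \<open>\<open>connected\<close> refers to the symmetric closure; since the arcs are
    already symmetric, it yields directed reachability.\<close>
  have "strongly_connected (with_proj G)"
    using assms(2) pair_sym_arcs by (intro symmetric_connected_imp_strongly_connected)
  then have "v \<rightarrow>\<^sup>*\<^bsub>with_proj G\<^esub> w"
    using w assms(4) by (auto simp: strongly_connected_def)
  then have "(v, w) \<in> (parcs G)\<^sup>+"
    using w(2) by auto
  then show thesis
    using that by (meson tranclD)
qed

text \<open>Ore's argument: if all neighbours of some \<open>d\<close> in \<open>D\<close> lay in
  \<open>D\<close>, then \<open>D - {d}\<close> would still dominate, with \<open>d\<close> covered
  by any of its neighbours, against the minimality of \<open>D\<close>.\<close>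

lemma gamma_set_complement_dominating:
  assumes G: "pair_graph G" and D: "gamma_set G D"
    and nbr: "\<And>v. v \<in> pverts G \<Longrightarrow> \<exists>u. (v, u) \<in> parcs G"
  shows "dominating_set G (pverts G - D)"
proof -
  interpret pair_graph G by fact
  have dom: "dominating_set G D" and card: "card D = domination_number G"
    using D by (auto simp: gamma_set_def)
  have sub: "D \<subseteq> pverts G" using dom by (simp add: dominating_set_def)
  have "\<exists>u \<in> pverts G - D. (d, u) \<in> parcs G" if d: "d \<in> D" for d
  proof (rule ccontr)
    assume "\<not> ?thesis"
    then have inner: "u \<in> D - {d}" if "(d, u) \<in> parcs G" for u
      using that by (auto dest: in_arcsD2 no_loops')
    have "dominating_set G (D - {d})"
      unfolding dominating_set_def
    proof (intro conjI ballI)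
      show "D - {d} \<subseteq> pverts G" using sub by blast
    next
      fix v assume v: "v \<in> pverts G - (D - {d})"
      show "\<exists>u \<in> D - {d}. (v, u) \<in> parcs G"
      proof (cases "v = d")
        case True
        then show ?thesis using nbr[of d] v inner by auto
      next
        case False
        then have "v \<in> pverts G - D" using v by blast
        then obtain u where u: "u \<in> D" "(v, u) \<in> parcs G"
          using dom by (auto simp: dominating_set_def)
        \<comment> \<open>For \<open>u = d\<close>, the vertex \<open>v\<close> would be a neighbour
          of \<open>d\<close> and so lie in \<open>D\<close> by \<open>inner\<close>.\<close>
        with inner arcs_symmetric \<open>v \<in> pverts G - D\<close> have "u \<noteq> d" by blast
        with u show ?thesis by blast
      qed
    qed
    then have "card D \<le> card (D - {d})"
      using domination_number_le[OF G] card by simp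
    moreover have "card (D - {d}) < card D"
      using d sub finite_subset pair_finite_verts by (metis card_Diff1_less)
    ultimately show False by simp
  qed
  then show ?thesis by (auto simp: dominating_set_def)
qed

theorem majority_roman_number_le_if_independent_complement:
  assumes G: "pair_graph G" and conn: "connected (with_proj G)" and n: "2 \<le> card (pverts G)"
    and D: "gamma_set G D" and ind: "independent_set G (pverts G - D)"
  shows "majority_roman_number G \<le> 3 * int (domination_number G) - int (card (pverts G))"
proof -
  interpret pair_graph G by fact
  let ?V = "pverts G"
  have dom: "dominating_set G D" and card: "card D = domination_number G"
    using D by (auto simp: gamma_set_def)
  have sub: "D \<subseteq> ?V" using dom by (simp add: dominating_set_def)
  have fin: "finite D" using sub pair_finite_verts by (rule finite_subset)
  \<comment> \<open>The restriction to \<open>?V\<close> makes \<open>f\<close> extensional, as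
    \<open>mrdf\<close> demands.\<close>
  define f where "f = (\<lambda>v\<in>?V. if v \<in> D then 2 else - 1 :: int)"
  have "dominating_set G (?V - D)"
    using connected_imp_neighbour[OF G conn n] by (intro gamma_set_complement_dominating[OF G D]) blast
  then have "card D \<le> card (?V - D)"
    using domination_number_le[OF G] card by simp
  moreover have split: "card ?V = card D + card (?V - D)"
    using sub fin pair_finite_verts by (simp add: card_Diff_subset card_mono)
  moreover have "?V - D \<subseteq> {v \<in> ?V. 1 \<le> sum f (closed_nbhd G v)}"
  proof
    fix v assume v: "v \<in> ?V - D"
    let ?N = "{u. (u, v) \<in> parcs G}"
    have N: "?N \<subseteq> D"
      using v ind by (auto simp: independent_set_def dest: in_arcsD1)
    obtain u where u: "u \<in> D" "(v, u) \<in> parcs G"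
      using v dom by (auto simp: dominating_set_def)
    then have "u \<in> ?N" using arcs_symmetric by auto
    moreover have finN: "finite ?N" using N fin by (rule finite_subset)
    ultimately have "1 \<le> card ?N"
      by (metis One_nat_def Suc_leI card_gt_0_iff empty_iff)
    moreover have "sum f ?N = (\<Sum>u\<in>?N. 2)"
      using N sub by (intro sum.cong) (auto simp: f_def)
    moreover have "v \<notin> ?N" using N v by blast
    moreover have "f v = - 1" using v by (simp add: f_def)
    \<comment> \<open>The sum equals \<open>2 * card ?N - 1\<close>.\<close>
    ultimately have "1 \<le> sum f (closed_nbhd G v)"
      using finN by (simp add: closed_nbhd_def)
    then show "v \<in> {v \<in> ?V. 1 \<le> sum f (closed_nbhd G v)}" using v by blast
  qed
  then have "card (?V - D) \<le> card {v \<in> ?V. 1 \<le> sum f (closed_nbhd G v)}"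
    using pair_finite_verts by (intro card_mono) auto
  \<comment> \<open>The complement of \<open>D\<close> is at least as large as \<open>D\<close>, so
    it contains at least half of the vertices.\<close>
  ultimately have "card ?V \<le> 2 * card {v \<in> ?V. 1 \<le> sum f (closed_nbhd G v)}"
    by linarith
  moreover have "\<exists>w\<in>?V. (u, w) \<in> parcs G \<and> f w = 2" if "u \<in> ?V" "f u = - 1" for u
  proof -
    have "u \<in> ?V - D" using that by (auto simp: f_def split: if_splits)
    then obtain w where "w \<in> D" "(u, w) \<in> parcs G"
      using dom by (auto simp: dominating_set_def)
    then show ?thesis using sub by (auto simp: f_def)
  qed
  ultimately have "mrdf G f"
    by (auto simp: mrdf_def f_def)
  then have "majority_roman_number G \<le> sum f ?V"
    by (rule majority_roman_number_le[OF G])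
  also have "sum f ?V = sum f (?V - D) + sum f D"
    using sub pair_finite_verts by (rule sum.subset_diff)
  also have "sum f (?V - D) = (\<Sum>v\<in>?V - D. - 1)"
    by (intro sum.cong) (auto simp: f_def)
  also have "sum f D = (\<Sum>v\<in>D. 2)"
    using sub by (intro sum.cong) (auto simp: f_def)
  finally show ?thesis
    using split card by simp
qed

section \<open>Paths are trees\<close>

lemma path_graph_simps [simp]:
  "pverts (path_graph n) = {..<n}"
  "(i, j) \<in> parcs (path_graph n) \<longleftrightarrow> i < n \<and> j < n \<and> (j = Suc i \<or> i = Suc j)"
  by (auto simp: path_graph_def)

lemma pair_graph_path_graph: "pair_graph (path_graph n)"
proof unfold_locales
  have "parcs (path_graph n) \<subseteq> {..<n} \<times> {..<n}" by auto
  then show "finite (parcs (path_graph n))"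
    by (rule finite_subset) simp
  show "symmetric (with_proj (path_graph n))"
    by (auto simp: symmetric_def intro!: symI)
qed auto

lemma connected_path_graph:
  assumes "0 < n"
  shows "connected (with_proj (path_graph n))"
proof -
  interpret pair_graph "path_graph n" by (rule pair_graph_path_graph)
  have from0: "0 \<rightarrow>\<^sup>*\<^bsub>with_proj (path_graph n)\<^esub> k" if "k < n" for k
    using that
  proof (induction k)
    case (Suc k)
    then have "0 \<rightarrow>\<^sup>*\<^bsub>with_proj (path_graph n)\<^esub> k" by simp
    moreover have "(k, Suc k) \<in> parcs (path_graph n)" using Suc.prems by simp
    ultimately show ?case by (rule reachable_adj_trans)
  qed simp
  have "i \<rightarrow>\<^sup>*\<^bsub>with_proj (path_graph n)\<^esub> j" if "i < n" "j < n" for i j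
    using that from0 symmetric_reachable' reachable_trans by blast
  then have reach: "(i, j) \<in> rtrancl_on {..<n} (parcs (path_graph n))" if "i < n" "j < n" for i j
    using that by (simp add: reachable_def)
  \<comment> \<open>Reachability passes to the symmetric closure, in which
    \<open>connected_conv\<close> expresses connectedness.\<close>
  have "(i, j) \<in> rtrancl_on {..<n} ((parcs (path_graph n))\<^sup>s)" if "i < n" "j < n" for i j
    using reach[OF that] by (rule rtrancl_on_mono[rotated 2]) (auto simp: symcl_def)
  then show ?thesis
    using assms by (auto simp: connected_conv)
qed

text \<open>A walk without repeated vertices can never turn back, so it sweeps the interval between
  its ends monotonically.\<close>

lemma apath_path_graph:
  assumes "pre_digraph.apath (with_proj (path_graph n)) a p b"
  shows "length p = max a b - min a b \<and> set (pawalk_verts a p) = {min a b..max a b}"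
  using assms
proof (induction p arbitrary: a)
  interpret pair_graph "path_graph n" by (rule pair_graph_path_graph)
  case Nil
  then show ?case by (simp add: apath_Nil_iff)
next
  interpret pair_graph "path_graph n" by (rule pair_graph_path_graph)
  case (Cons e p)
  obtain x where e: "e = (a, x)" and arc: "x = Suc a \<or> a = Suc x"
    and ap: "apath x p b" and a: "a \<notin> set (pawalk_verts x p)"
    using Cons.prems by (cases e) (auto simp: apath_Cons_iff)
  note IH = Cons.IH[OF ap]
  \<comment> \<open>The rest of the walk covers the interval from \<open>x\<close> to
    \<open>b\<close> and avoids \<open>a\<close>; as \<open>x\<close> is next to \<open>a\<close>,
    the first arc leads towards \<open>b\<close>.\<close>
  then have "a < min x b \<or> max x b < a" using a by auto
  with arc have "x = Suc a \<and> x \<le> b \<or> a = Suc x \<and> b \<le> x" by linarith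
  with IH e show ?case by auto
qed

text \<open>Without its first arc, a cycle becomes a simple walk between two adjacent vertices. By
  \<open>apath_path_graph\<close> this walk has length 1, so the cycle has length 2.\<close>

lemma undirected_tree_path_graph:
  assumes "0 < n"
  shows "undirected_tree (path_graph n)"
proof -
  interpret pair_graph "path_graph n" by (rule pair_graph_path_graph)
  have False if cyc: "cycle p" and len: "3 \<le> length p" for p
  proof -
    from cyc obtain u where u: "awalk u p u" "distinct (tl (pawalk_verts u p))"
      by (auto simp: cycle_def)
    obtain e q where p: "p = e # q" using len by (cases p) auto
    obtain x where "x = Suc u \<or> u = Suc x" and "apath x q u"
      using u p by (cases e) (auto simp: awalk_Cons_iff apath_def)
    with apath_path_graph len p show False by fastforce
  qed
  then show ?thesis
    unfolding undirected_tree_def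
    using assms pair_graph_path_graph connected_path_graph by blast
qed

section \<open>Sharpness on the path with five vertices\<close>

lemma gamma_set_path_graph_5: "gamma_set (path_graph 5) {1, 3}"
proof -
  have dom: "dominating_set (path_graph 5) {1, 3}"
    by (auto simp: dominating_set_def less_Suc_eq numeral_eq_Suc)
  have "2 \<le> card S" if S: "dominating_set (path_graph 5) S" for S
  proof -
    have sub: "S \<subseteq> {..<5}" using S by (simp add: dominating_set_def)
    \<comment> \<open>Dominating the two end vertices takes two elements, because their closed
      neighbourhoods are disjoint.\<close>
    have "0 \<in> S \<or> 1 \<in> S" "3 \<in> S \<or> 4 \<in> S"
      using S by (fastforce simp: dominating_set_def)+
    then obtain i j where "i \<in> S" "j \<in> S" "i \<noteq> j"
      by (metis numeral_eq_iff one_eq_numeral_iff semiring_norm zero_neq_numeral)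
    then have "{i, j} \<subseteq> S" "card {i, j} = 2" by auto
    then show ?thesis
      using sub finite_subset by (metis card_mono finite_lessThan)
  qed
  then have "domination_number (path_graph 5) = 2"
    unfolding domination_number_def
    using dom dominating_sets_finite_nonempty(1)[OF pair_graph_path_graph]
    by (intro Min_eqI) (auto intro!: image_eqI[of _ _ "{1, 3}"])
  then show ?thesis using dom by (simp add: gamma_set_def)
qed

text \<open>With \<open>m\<close> values 2 and \<open>k\<close> values -1 the weight is
  \<open>5 + m - 2 * k\<close>, where \<open>k\<close> is at most \<open>2 * m\<close> and at most
  \<open>5 - m\<close>. The least value 1 allowed by these bounds occurs at \<open>m = 2\<close>,
  \<open>k = 3\<close>.\<close>

lemma mrdf_path_graph_5_weight:
  assumes "mrdf (path_graph 5) f"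
  shows "1 \<le> sum f {..<5}"
proof -
  have vals: "f i = - 1 \<or> f i = 1 \<or> f i = 2" if "i < 5" for i
    using assms that by (auto simp: mrdf_def PiE_iff)
  have nbr: "\<exists>w<5. (w = Suc u \<or> u = Suc w) \<and> f w = 2" if "u < 5" "f u = - 1" for u
    using assms that by (auto simp: mrdf_def)
  have "f 0 = - 1 \<Longrightarrow> f 1 = 2" "f 1 = - 1 \<Longrightarrow> f 0 = 2 \<or> f 2 = 2"
    "f 2 = - 1 \<Longrightarrow> f 1 = 2 \<or> f 3 = 2" "f 3 = - 1 \<Longrightarrow> f 2 = 2 \<or> f 4 = 2"
    "f 4 = - 1 \<Longrightarrow> f 3 = 2"
    using nbr[of 0] nbr[of 1] nbr[of 2] nbr[of 3] nbr[of 4]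
    by (auto simp: numeral_eq_Suc)
  moreover have "sum f {..<5} = f 0 + f 1 + f 2 + f 3 + f 4"
    by (simp add: numeral_eq_Suc)
  ultimately show ?thesis
    using vals[of 0] vals[of 1] vals[of 2] vals[of 3] vals[of 4] by auto
qed

theorem theorem12:
  shows "(\<forall>T :: 'a pair_pre_digraph.
            undirected_tree T \<longrightarrow> 2 \<le> card (pverts T) \<longrightarrow>
            (\<exists>D. gamma_set T D \<and> independent_set T (pverts T - D)) \<longrightarrow>
            majority_roman_number T \<le> 3 * int (domination_number T) - int (card (pverts T)))
       \<and> (undirected_tree (path_graph 5) \<and> 2 \<le> card (pverts (path_graph 5)) \<and>
          (\<exists>D. gamma_set (path_graph 5) D \<and> independent_set (path_graph 5) (pverts (path_graph 5) - D)) \<and>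
          majority_roman_number (path_graph 5) =
            3 * int (domination_number (path_graph 5)) - int (card (pverts (path_graph 5))))"
proof (intro conjI allI impI)
  fix T :: "'a pair_pre_digraph"
  assume "undirected_tree T" "2 \<le> card (pverts T)"
    "\<exists>D. gamma_set T D \<and> independent_set T (pverts T - D)"
  then show "majority_roman_number T \<le> 3 * int (domination_number T) - int (card (pverts T))"
    using majority_roman_number_le_if_independent_complement
    unfolding undirected_tree_def by blast
next
  let ?P = "path_graph 5"
  show "undirected_tree ?P" by (simp add: undirected_tree_path_graph)
  show n: "2 \<le> card (pverts ?P)" by simp
  have ind: "independent_set ?P (pverts ?P - {1, 3})"
    by (auto simp: independent_set_def less_Suc_eq numeral_eq_Suc)
  with gamma_set_path_graph_5
  show "\<exists>D. gamma_set ?P D \<and> independent_set ?P (pverts ?P - D)" by blast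
  have "domination_number ?P = 2"
    using gamma_set_path_graph_5 by (simp add: gamma_set_def)
  \<comment> \<open>This matches the upper bound, which is 3 * 2 - 5 = 1.\<close>
  moreover have "1 \<le> majority_roman_number ?P"
    unfolding majority_roman_number_def
    using mrdfs_finite_nonempty[OF pair_graph_path_graph, of 5] mrdf_path_graph_5_weight
    by (subst Min_ge_iff) auto
  moreover have "majority_roman_number ?P \<le> 3 * int (domination_number ?P) - int (card (pverts ?P))"
    using majority_roman_number_le_if_independent_complement[OF pair_graph_path_graph _ n
        gamma_set_path_graph_5 ind] by (simp add: connected_path_graph)
  ultimately show "majority_roman_number ?P
      = 3 * int (domination_number ?P) - int (card (pverts ?P))"
    by simp
qed

end
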